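(* Suppose that $A$ is $\nu$-strongly monotone for some $\nu>0$ and let $\bar x$ be the unique element of $\operatorname{zer}(A+B)$ (assumed nonempty). Let the step sizes be $\gamma_n=\frac1{2\nu(n+1)}$ for $n\in\mathbb N$, and let $(x_n)$ be generated by the reflected stochastic forward–backward iteration with these step sizes. Suppose there is a constant $c$ such that $\mathsf E[\|r_n-By_n\|^2\mid\mathcal F_n]\le c$ for all $n\in\mathbb N$. Then $$\mathsf E\big[\|x_n-\bar x\|^2\big]=\mathcal O\big(\log(n+1)/(n+1)\big)\quad (n>n_0),$$ where $n_0$ is the smallest integer such that $n_0>4\nu^{-1}\mu(1+\sqrt2)$.
   Context: $\mathcal H$ is a separable real Hilbert space; $(\Omega,\mathcal F,\mathsf P)$ a probability space. $A:\mathcal H\to2^{\mathcal H}$ is maximally monotone; $B:\mathcal H\to\mathcal H$ is monotone and $\mu$-Lipschitz continuous ($\mu>0$). $A$ is $\nu$-strongly monotone if $\langle x-y,u-v\rangle\ge\nu\|x-y\|^2$ for all $(x,u),(y,v)\in\operatorname{gra}A$. $J_{\gamma A}=(\mathrm{Id}+\gamma A)^{-1}$. Reflected stochastic forward–backward iteration: $x_0,x_{-1}$ are square-integrable $\mathcal H$-valued random variables, and for every $n\in\mathbb N$: $y_n=2x_n-x_{n-1}$; $r_n$ is an $\mathcal H$-valued random variable with $\mathsf E[r_n\mid\mathcal F_n]=By_n$, where $\mathcal F_n=\sigma(x_0,\dots,x_n)$; and $x_{n+1}=J_{\gamma_nA}(x_n-\gamma_nr_n)$. *)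

theory Defs
  imports "HOL-Probability.Probability"
begin

definition monotone_op :: "('a::real_inner \<Rightarrow> 'a set) \<Rightarrow> bool" where
  "monotone_op A \<longleftrightarrow> (\<forall>x y u v. u \<in> A x \<longrightarrow> v \<in> A y \<longrightarrow> inner (x - y) (u - v) \<ge> 0)"

definition maximally_monotone :: "('a::real_inner \<Rightarrow> 'a set) \<Rightarrow> bool" where
  "maximally_monotone A \<longleftrightarrow> monotone_op A \<and>
     (\<forall>A'. monotone_op A' \<longrightarrow> (\<forall>x. A x \<subseteq> A' x) \<longrightarrow> A' = A)"

definition strongly_monotone :: "real \<Rightarrow> ('a::real_inner \<Rightarrow> 'a set) \<Rightarrow> bool" where
  "strongly_monotone \<nu> A \<longleftrightarrow>
     (\<forall>x y u v. u \<in> A x \<longrightarrow> v \<in> A y \<longrightarrow> inner (x - y) (u - v) \<ge> \<nu> * (norm (x - y))\<^sup>2)"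

definition monotone_fun :: "('a::real_inner \<Rightarrow> 'a) \<Rightarrow> bool" where
  "monotone_fun B \<longleftrightarrow> (\<forall>x y. inner (x - y) (B x - B y) \<ge> 0)"

definition lipschitz_fun :: "real \<Rightarrow> ('a::real_normed_vector \<Rightarrow> 'a) \<Rightarrow> bool" where
  "lipschitz_fun \<mu> B \<longleftrightarrow> (\<forall>x y. norm (B x - B y) \<le> \<mu> * norm (x - y))"

text \<open>Resolvent \<open>J_{\<gamma>A} = (Id + \<gamma>A)^{-1}\<close>: \<open>p = J x\<close> iff \<open>x \<in> p + \<gamma> A p\<close>
  (single-valued for maximally monotone \<open>A\<close> and \<open>\<gamma> > 0\<close>).\<close>
definition resolvent :: "real \<Rightarrow> ('a::real_inner \<Rightarrow> 'a set) \<Rightarrow> 'a \<Rightarrow> 'a" where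
  "resolvent \<gamma> A x = (THE p. x \<in> (\<lambda>u. p + \<gamma> *\<^sub>R u) ` A p)"

definition zer_sum :: "('a::real_vector \<Rightarrow> 'a set) \<Rightarrow> ('a \<Rightarrow> 'a) \<Rightarrow> 'a set" where
  "zer_sum A B = {x. 0 \<in> (\<lambda>u. u + B x) ` A x}"

definition nat_filtration :: "'w measure \<Rightarrow> (nat \<Rightarrow> 'w \<Rightarrow> 'a::topological_space) \<Rightarrow> nat \<Rightarrow> 'w measure" where
  "nat_filtration M x n =
     sigma (space M) (\<Union>k\<in>{..n}. (\<lambda>U. x k -` U \<inter> space M) ` sets borel)"

definition is_cond_exp ::
  "'w measure \<Rightarrow> 'w measure \<Rightarrow> ('w \<Rightarrow> 'a::{banach,second_countable_topology}) \<Rightarrow> ('w \<Rightarrow> 'a) \<Rightarrow> bool" where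
  "is_cond_exp M F X Z \<longleftrightarrow> integrable M X \<and>
     (\<exists>Z'. Z' \<in> borel_measurable F \<and> integrable M Z' \<and> (AE \<omega> in M. Z' \<omega> = Z \<omega>) \<and>
        (\<forall>S\<in>sets F. set_lebesgue_integral M S X = set_lebesgue_integral M S Z'))"

text \<open>Reflected point \<open>y_n = 2 x_n - x_{n-1}\<close>, with \<open>xm\<close> playing the role of \<open>x_{-1}\<close>.\<close>
definition refl_pt :: "('w \<Rightarrow> 'a::real_vector) \<Rightarrow> (nat \<Rightarrow> 'w \<Rightarrow> 'a) \<Rightarrow> nat \<Rightarrow> 'w \<Rightarrow> 'a" where
  "refl_pt xm x n \<omega> = 2 *\<^sub>R x n \<omega> - (if n = 0 then xm \<omega> else x (n - 1) \<omega>)"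

end

(* With V_n = E|x_n - xbar|^2 + E|x_n - x_{n-1}|^2 / 8 and k = n + 1, strong monotonicity of A,
   monotonicity and Lipschitz continuity of B, and orthogonality of the noise r_n - B y_n to the
   F_n-measurable vector x_n - xbar give
     (1 + 1/k - L/k^2) V_{n+1} <= V_n + K/k^2.
   The loss L/k^2 is only a bounded factor: weighting k V_{k-1} by 1 + 2L/k turns the recursion into
   a telescoping one with increments O(1/k), whence k V_{k-1} = O(log k);
   finitely many initial terms only change the constant. *)

theory Submission
  imports Defs
begin

text \<open>The reflection forces the increment term in V_n: since y_n - x_{n+1} = (x_n - x_{n-1}) -
  (x_{n+1} - x_n), the Lipschitz error of replacing B x_{n+1} by B y_n is paid for by two successive
  increments. The implicit step supplies -|x_{n+1} - x_n|^2; the noise takes 1/2 of it, the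
  Lipschitz error takes 1/8 (and 1/8 of the previous increment), and the remaining 3/8 restores the
  increment term in V_{n+1}. Two obstacles lie outside this computation. \<open>resolvent\<close> is
  a definite description, so the iteration gives no inclusion in \<open>A\<close> until Minty's
  theorem provides existence; it is proved by minimising a quadratic over the convex hull of a
  graph. Moreover, second moments are assumed only for the two starting vectors: square
  integrability is carried along the iteration by the variance bound and the nonexpansive resolvents
  before any expectation is split.\<close>

section \<open>Pointwise estimate for one iteration\<close>

lemma power2_norm_add_scaleR:
  fixes a b :: "'a::real_inner"
  shows "(norm (a + \<theta> *\<^sub>R b))\<^sup>2 = (norm a)\<^sup>2 + 2 * \<theta> * inner a b + \<theta>\<^sup>2 * (norm b)\<^sup>2"
  unfolding power2_norm_eq_inner
  by (simp add: inner_add_left inner_add_right inner_commute power2_eq_square)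

lemma power2_norm_diff_le:
  fixes a b :: "'a::real_inner"
  shows "(norm (a - b))\<^sup>2 \<le> 2 * (norm a)\<^sup>2 + 2 * (norm b)\<^sup>2"
proof -
  have "(norm (a - b))\<^sup>2 + (norm (a + b))\<^sup>2 = 2 * (norm a)\<^sup>2 + 2 * (norm b)\<^sup>2"
    unfolding power2_norm_eq_inner
    by (simp add: inner_add_left inner_add_right inner_diff_left inner_diff_right inner_commute)
  moreover have "0 \<le> (norm (a + b))\<^sup>2" by simp
  ultimately show ?thesis by linarith
qed

text \<open>Strong monotonicity is tested on \<open>x1\<close> and \<open>xbar\<close>, with
  \<open>- B xbar\<close> as the element of \<open>A xbar\<close>. Splitting
  \<open>B y - B xbar\<close> at \<open>B x1\<close> leaves a part signed by monotonicity of
  \<open>B\<close> and a Lipschitz remainder. The noise is finally paired with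
  \<open>x0 - xbar\<close>, which is known before \<open>r\<close> is drawn.\<close>

lemma forward_backward_step:
  fixes A :: "'a::real_inner \<Rightarrow> 'a set"
  assumes A_strong: "strongly_monotone \<nu> A"
    and B_mono: "monotone_fun B" and B_lip: "lipschitz_fun \<mu> B"
    and xbar: "xbar \<in> zer_sum A B" and "\<gamma> > 0"
    and x1: "(x0 - \<gamma> *\<^sub>R r - x1) /\<^sub>R \<gamma> \<in> A x1" and y: "y = 2 *\<^sub>R x0 - xp"
  shows "(1 + 2 * \<nu> * \<gamma> - 16 * \<gamma>\<^sup>2 * \<mu>\<^sup>2) * (norm (x1 - xbar))\<^sup>2 + 3 / 8 * (norm (x1 - x0))\<^sup>2
    \<le> (norm (x0 - xbar))\<^sup>2 + 1 / 8 * (norm (x0 - xp))\<^sup>2 + 2 * \<gamma>\<^sup>2 * (norm (r - B y))\<^sup>2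
      - 2 * \<gamma> * inner (x0 - xbar) (r - B y)"
proof -
  define P Q e where "P = x1 - xbar" and "Q = x0 - xbar" and "e = r - B y"
  define t where "t = norm (y - x1)"
  have PQ: "x1 - x0 = P - Q" by (simp add: P_def Q_def)
  obtain u where "u \<in> A xbar" "u + B xbar = 0"
    using xbar by (auto simp: zer_sum_def)
  then have "- B xbar \<in> A xbar" by (simp add: eq_neg_iff_add_eq_0[symmetric])
  with x1 A_strong
  have "\<nu> * (norm P)\<^sup>2 \<le> inner P ((x0 - \<gamma> *\<^sub>R r - x1) /\<^sub>R \<gamma> - (- B xbar))"
    unfolding strongly_monotone_def P_def by blast
  also have "(x0 - \<gamma> *\<^sub>R r - x1) /\<^sub>R \<gamma> - (- B xbar)
      = (1 / \<gamma>) *\<^sub>R (Q - P) - e - (B y - B x1) - (B x1 - B xbar)"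
    using \<open>\<gamma> > 0\<close> by (simp add: P_def Q_def e_def algebra_simps inverse_eq_divide)
  also have "inner P \<dots> \<le> (1 / \<gamma>) * (inner P Q - (norm P)\<^sup>2) - inner P e - inner P (B y - B x1)"
  proof -
    have "0 \<le> inner P (B x1 - B xbar)" using B_mono unfolding monotone_fun_def P_def by blast
    moreover have "inner P ((1 / \<gamma>) *\<^sub>R (Q - P) - e - (B y - B x1) - (B x1 - B xbar))
        = (1 / \<gamma>) * (inner P Q - inner P P) - inner P e - inner P (B y - B x1) - inner P (B x1 - B xbar)"
      by (simp only: inner_diff_right inner_scaleR_right)
    ultimately show ?thesis by (simp add: power2_norm_eq_inner)
  qed
  finally have "\<gamma> * (\<nu> * (norm P)\<^sup>2)
      \<le> \<gamma> * ((1 / \<gamma>) * (inner P Q - (norm P)\<^sup>2) - inner P e - inner P (B y - B x1))"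
    using \<open>\<gamma> > 0\<close> by (intro mult_left_mono) auto
  then have 1: "\<gamma> * \<nu> * (norm P)\<^sup>2 \<le> inner P Q - (norm P)\<^sup>2 - \<gamma> * inner P e - \<gamma> * inner P (B y - B x1)"
    using \<open>\<gamma> > 0\<close> by (simp add: right_diff_distrib)
  have 2: "2 * inner P Q = (norm P)\<^sup>2 + (norm Q)\<^sup>2 - (norm (P - Q))\<^sup>2"
    unfolding power2_norm_eq_inner by (simp add: inner_diff_left inner_diff_right inner_commute)
  \<comment> \<open>Young's inequality moves the noise from \<open>P\<close> to \<open>Q\<close>:
    \<open>P\<close> depends on \<open>r\<close>, so \<open>inner P e\<close> need not have mean
    zero. The price is half of the squared increment.\<close>
  have "0 \<le> (norm ((P - Q) + (2 * \<gamma>) *\<^sub>R e))\<^sup>2" by simp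
  then have "0 \<le> (norm (P - Q))\<^sup>2 + 4 * (\<gamma> * inner (P - Q) e) + 4 * (\<gamma>\<^sup>2 * (norm e)\<^sup>2)"
    unfolding power2_norm_add_scaleR by (simp add: power_mult_distrib)
  moreover have "\<gamma> * inner P e = \<gamma> * inner (P - Q) e + \<gamma> * inner Q e"
    by (simp add: inner_diff_left right_diff_distrib)
  ultimately have 3: "- 2 * (\<gamma> * inner P e)
      \<le> 1 / 2 * (norm (P - Q))\<^sup>2 + 2 * (\<gamma>\<^sup>2 * (norm e)\<^sup>2) - 2 * (\<gamma> * inner Q e)"
    by linarith
  have "- inner P (B y - B x1) \<le> norm P * norm (B y - B x1)"
    using norm_cauchy_schwarz[of "- P" "B y - B x1"] by simp
  also have "\<dots> \<le> norm P * (\<mu> * t)"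
    using B_lip unfolding lipschitz_fun_def t_def by (intro mult_left_mono) auto
  finally have "\<gamma> * (- inner P (B y - B x1)) \<le> \<gamma> * (norm P * (\<mu> * t))"
    using \<open>\<gamma> > 0\<close> by (intro mult_left_mono) auto
  \<comment> \<open>The weight 4 leaves \<open>t\<close> with coefficient 1/16, which the bound on
    the squared \<open>t\<close> below turns into 1/8 for each of the two increments. The loss on
    \<open>P\<close> is of second order in the step size.\<close>
  moreover have "2 * (\<gamma> * (norm P * (\<mu> * t))) \<le> 16 * \<gamma>\<^sup>2 * \<mu>\<^sup>2 * (norm P)\<^sup>2 + t\<^sup>2 / 16"
    using zero_le_power2[of "4 * \<gamma> * \<mu> * norm P - t / 4"]
    by (simp add: power2_diff power_mult_distrib power_divide mult_ac)
  ultimately have 4: "- 2 * (\<gamma> * inner P (B y - B x1)) \<le> 16 * \<gamma>\<^sup>2 * \<mu>\<^sup>2 * (norm P)\<^sup>2 + t\<^sup>2 / 16"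
    by (simp only: mult_minus_left mult_minus_right)
  have "y - x1 = (x0 - xp) - (P - Q)" by (simp add: y P_def Q_def scaleR_2)
  then have t_eq: "t = norm ((x0 - xp) - (P - Q))" by (simp only: t_def)
  have 5: "t\<^sup>2 \<le> 2 * (norm (x0 - xp))\<^sup>2 + 2 * (norm (P - Q))\<^sup>2"
    unfolding t_eq by (rule power2_norm_diff_le)
  show ?thesis
    unfolding PQ P_def[symmetric] Q_def[symmetric] e_def[symmetric]
    using 1 2 3 4 5 by (simp add: algebra_simps)
qed

section \<open>Convex minimisation and Minty's theorem\<close>

text \<open>First-order optimality for the infimum of \<open>(norm z)\<^sup>2 / 4 + t\<close> over a convex set; the infimum
  need not be attained, but strong convexity makes the \<open>z\<close>-components of a minimising sequence converge.\<close>
lemma convex_quadratic_certificate: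
  fixes S :: "('a::{real_inner,complete_space} \<times> real) set"
  assumes cv: "convex S"
    and nonneg: "\<And>z t. (z, t) \<in> S \<Longrightarrow> 0 \<le> (norm z)\<^sup>2 / 4 + t"
  shows "\<exists>z. \<forall>(w, t)\<in>S. 0 \<le> inner z w / 2 - (norm z)\<^sup>2 / 4 + t"
proof (cases "S = {}")
  case False
  define g where "g = (\<lambda>(z::'a, t::real). (norm z)\<^sup>2 / 4 + t)"
  define s where "s = Inf (g ` S)"
  have g0: "0 \<le> g k" if "k \<in> S" for k
    using nonneg that by (cases k) (auto simp: g_def)
  have bdd: "bdd_below (g ` S)"
    using g0 by (auto intro!: bdd_belowI2)
  have s_le: "s \<le> g k" if "k \<in> S" for k
    unfolding s_def using bdd that by (auto intro!: cInf_lower)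
  have s0: "0 \<le> s"
    unfolding s_def using False g0 by (intro cInf_greatest) auto
  have "\<exists>k\<in>S. g k < s + 1 / real (Suc n)" for n
  proof -
    have "Inf (g ` S) < s + 1 / real (Suc n)" unfolding s_def by simp
    then show ?thesis using False bdd by (subst (asm) cInf_less_iff) auto
  qed
  then obtain k where kS: "\<And>n. k n \<in> S" and kg: "\<And>n. g (k n) < s + 1 / real (Suc n)"
    by metis
  define z where "z n = fst (k n)" for n
  \<comment> \<open>Compares the infimum with the segment from \<open>k n\<close> to
    \<open>(w, t)\<close>. Eliminating \<open>snd (k n)\<close> through \<open>g (k n)\<close> makes
    the limit depend only on \<open>z n\<close> and on values tending to \<open>s\<close>.\<close>
  have step: "s \<le> g (k n) + \<theta> * (inner (z n) (w - z n) / 2 + t - (g (k n) - (norm (z n))\<^sup>2 / 4))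
                  + \<theta>\<^sup>2 * (norm (w - z n))\<^sup>2 / 4"
    if "(w, t) \<in> S" "0 \<le> \<theta>" "\<theta> \<le> 1" for w t \<theta> n
  proof -
    have "(1 - \<theta>) *\<^sub>R k n + \<theta> *\<^sub>R (w, t) \<in> S"
      by (rule convexD_alt[OF cv kS that])
    moreover have "(1 - \<theta>) *\<^sub>R k n + \<theta> *\<^sub>R (w, t)
        = (z n + \<theta> *\<^sub>R (w - z n), snd (k n) + \<theta> * (t - snd (k n)))"
      by (cases "k n") (simp add: z_def algebra_simps)
    ultimately have "s \<le> (norm (z n + \<theta> *\<^sub>R (w - z n)))\<^sup>2 / 4 + (snd (k n) + \<theta> * (t - snd (k n)))"
      using s_le by (fastforce simp: g_def)
    moreover have "snd (k n) = g (k n) - (norm (z n))\<^sup>2 / 4"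
      by (simp add: g_def z_def split: prod.split)
    ultimately show ?thesis
      unfolding power2_norm_add_scaleR by (simp add: field_simps)
  qed
  \<comment> \<open>Parallelogram law: the value at the midpoint drops below the average by a
    sixteenth of the squared distance, yet it cannot drop below \<open>s\<close>.\<close>
  have dist_bound: "(norm (z n - z m))\<^sup>2 \<le> 8 * (1 / real (Suc n) + 1 / real (Suc m))" for n m
  proof -
    have mid: "(1/2) *\<^sub>R k n + (1/2) *\<^sub>R k m \<in> S"
      using cv kS by (auto simp: convex_def)
    have "g ((1/2) *\<^sub>R k n + (1/2) *\<^sub>R k m) = g (k n) / 2 + g (k m) / 2 - (norm (z n - z m))\<^sup>2 / 16"
    proof -
      have "(norm ((1/2) *\<^sub>R z n + (1/2) *\<^sub>R z m))\<^sup>2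
          = (norm (z n))\<^sup>2 / 2 + (norm (z m))\<^sup>2 / 2 - (norm (z n - z m))\<^sup>2 / 4"
        unfolding power2_norm_eq_inner
        by (simp add: inner_add_left inner_add_right inner_diff_left inner_diff_right inner_commute field_simps)
      then show ?thesis
        by (simp add: g_def z_def split: prod.split) (auto simp: field_simps)
    qed
    with s_le[OF mid] have "s \<le> g (k n) / 2 + g (k m) / 2 - (norm (z n - z m))\<^sup>2 / 16"
      by (simp only:)
    with kg[of n] kg[of m] show ?thesis unfolding distrib_left by linarith
  qed
  have inv0: "(\<lambda>n. 1 / real (Suc n)) \<longlonglongrightarrow> 0"
    using LIMSEQ_inverse_real_of_nat by (simp add: inverse_eq_divide)
  have "Cauchy z"
  proof (rule metric_CauchyI)
    fix e :: real assume e: "0 < e"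
    obtain N where N: "\<And>n. n \<ge> N \<Longrightarrow> 1 / real (Suc n) < e\<^sup>2 / 16"
      using order_tendstoD(2)[OF inv0, of "e\<^sup>2 / 16"] e by (auto simp: eventually_sequentially)
    show "\<exists>N. \<forall>m\<ge>N. \<forall>n\<ge>N. dist (z m) (z n) < e"
    proof (intro exI allI impI)
      fix m n assume "m \<ge> N" "n \<ge> N"
      then have "(norm (z m - z n))\<^sup>2 < e\<^sup>2"
        using dist_bound[of m n] N[of m] N[of n] unfolding distrib_left by linarith
      then show "dist (z m) (z n) < e"
        unfolding dist_norm using e by (intro power_less_imp_less_base[of _ 2 e]) auto
    qed
  qed
  then obtain l where l: "z \<longlonglongrightarrow> l"
    using Cauchy_convergent convergent_def by blast
  have gl: "(\<lambda>n. g (k n)) \<longlonglongrightarrow> s"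
  proof (rule tendsto_sandwich[OF _ _ tendsto_const])
    show "\<forall>\<^sub>F n in sequentially. s \<le> g (k n)" using s_le kS by simp
    show "\<forall>\<^sub>F n in sequentially. g (k n) \<le> s + 1 / real (Suc n)" using kg less_imp_le by (intro always_eventually) blast
    show "(\<lambda>n. s + 1 / real (Suc n)) \<longlonglongrightarrow> s"
      using tendsto_add[OF tendsto_const inv0, of s] by simp
  qed
  have "0 \<le> inner l w / 2 - (norm l)\<^sup>2 / 4 + t" if wt: "(w, t) \<in> S" for w t
  proof -
    \<comment> \<open>\<open>E\<close> is the first-order coefficient at the limit point. It is
      nonnegative because dividing by \<theta> and letting it tend to 0 removes the quadratic
      term.\<close>
    define E where "E = inner l (w - l) / 2 + t - (s - (norm l)\<^sup>2 / 4)"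
    define D where "D = (norm (w - l))\<^sup>2 / 4"
    have lim: "s \<le> s + \<theta> * E + \<theta>\<^sup>2 * (norm (w - l))\<^sup>2 / 4" if "0 \<le> \<theta>" "\<theta> \<le> 1" for \<theta>
    proof (rule tendsto_lowerbound)
      show "(\<lambda>n. g (k n) + \<theta> * (inner (z n) (w - z n) / 2 + t - (g (k n) - (norm (z n))\<^sup>2 / 4))
                  + \<theta>\<^sup>2 * (norm (w - z n))\<^sup>2 / 4) \<longlonglongrightarrow> s + \<theta> * E + \<theta>\<^sup>2 * (norm (w - l))\<^sup>2 / 4"
        unfolding E_def by (intro tendsto_intros l gl) auto
    qed (use step[OF wt that] in auto)
    have ED: "0 \<le> E + \<theta> * D" if "0 < \<theta>" "\<theta> \<le> 1" for \<theta>
    proof -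
      have "0 \<le> \<theta> * (E + \<theta> * D)"
        using lim[of \<theta>] that by (simp add: D_def algebra_simps power2_eq_square)
      then show ?thesis using that by (simp add: zero_le_mult_iff)
    qed
    have "0 \<le> E"
    proof (rule tendsto_lowerbound)
      have "(\<lambda>n. E + 1 / real (Suc n) * D) \<longlonglongrightarrow> E + 0 * D"
        by (intro tendsto_intros inv0)
      then show "(\<lambda>n. E + 1 / real (Suc n) * D) \<longlonglongrightarrow> E" by simp
      show "\<forall>\<^sub>F n in sequentially. 0 \<le> E + 1 / real (Suc n) * D"
        by (intro always_eventually allI ED) auto
    qed auto
    \<comment> \<open>\<open>E\<close> is the claimed expression minus \<open>s\<close>, and
      \<open>s\<close> is nonnegative.\<close>
    then show ?thesis
      using s0 by (simp add: E_def inner_simps power2_norm_eq_inner algebra_simps diff_divide_distrib)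
  qed
  then show ?thesis by blast
qed simp

text \<open>Lets the noise terms \<open>K / k\<close> telescope into a logarithm; the factor 2 pays
  for passing from \<open>1 / (x + 1)\<close> to \<open>1 / x\<close>.\<close>

lemma reciprocal_le_ln_diff:
  fixes x :: real
  assumes "x \<ge> 1"
  shows "1 / x \<le> 2 * (ln (x + 1) - ln x)"
proof -
  have "ln (x / (x + 1)) \<le> x / (x + 1) - 1" using assms by (intro ln_le_minus_one) simp
  then have "1 / (x + 1) \<le> ln (x + 1) - ln x" using assms by (simp add: ln_div field_simps)
  moreover have "1 / x \<le> 2 * (1 / (x + 1))" using assms by (simp add: field_simps)
  ultimately show ?thesis by (meson mult_left_mono order_trans zero_le_numeral)
qed

text \<open>The variational half of Minty's theorem: \<open>(p, - p)\<close> is monotonically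
  related to all of \<open>G\<close>. On the hull, \<open>t\<close> dominates
  \<open>inner x u\<close>, and |x + u|^2 / 4 = |x - u|^2 / 4 + inner x u; so |z|^2 / 4 + t is
  nonnegative at z = x - u and the convex certificate applies.\<close>

lemma monotone_graph_extension_point:
  fixes G :: "('a::{real_inner,complete_space} \<times> 'a) set"
  assumes mono: "\<And>x u y v. (x, u) \<in> G \<Longrightarrow> (y, v) \<in> G \<Longrightarrow> 0 \<le> inner (x - y) (u - v)"
  shows "\<exists>p. \<forall>(x, u)\<in>G. 0 \<le> inner (p - x) (- p - u)"
proof -
  \<comment> \<open>\<open>inner x u \<le> t\<close> holds on the hull: monotonicity gives the bilinear inequality on pairs of generators,
    and it extends to the hull in one argument at a time.\<close>
  define K where "K = convex hull ((\<lambda>(x, u). (x, u, inner x u)) ` G)"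
  define S where "S = (\<lambda>(x, u, t). (x - u, t)) ` K"
  have half: "0 \<le> t + inner x u - inner x v - inner y u"
    if "(x, u) \<in> G" "(y, v, t) \<in> K" for x u y v t
  proof -
    have "K \<subseteq> {(y, v, t). 0 \<le> t + inner x u - inner x v - inner y u}"
      unfolding K_def
    proof (rule hull_minimal)
      show "(\<lambda>(x, u). (x, u, inner x u)) ` G \<subseteq> {(y, v, t). 0 \<le> t + inner x u - inner x v - inner y u}"
        using mono[OF that(1)] by (fastforce simp: inner_simps inner_commute)
      have "0 \<le> a * t + b * t' + inner x u - inner x (a *\<^sub>R v + b *\<^sub>R v') - inner (a *\<^sub>R y + b *\<^sub>R y') u"
        if "0 \<le> t + inner x u - inner x v - inner y u" "0 \<le> t' + inner x u - inner x v' - inner y' u"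
          "0 \<le> a" "0 \<le> b" "a + b = 1" for a b t t' y y' v v'
      proof -
        have "0 \<le> a * (t + inner x u - inner x v - inner y u) + b * (t' + inner x u - inner x v' - inner y' u)"
          using that by simp
        also have "\<dots> = a * t + b * t' + (a + b) * inner x u - inner x (a *\<^sub>R v + b *\<^sub>R v') - inner (a *\<^sub>R y + b *\<^sub>R y') u"
          by (simp add: inner_simps algebra_simps)
        finally show ?thesis using that by simp
      qed
      then show "convex {(y, v, t). 0 \<le> t + inner x u - inner x v - inner y u}"
        by (auto simp: convex_def)
    qed
    with that(2) show ?thesis by auto
  qed
  have full: "0 \<le> s + t - inner x v - inner y u"
    if "(x, u, s) \<in> K" "(y, v, t) \<in> K" for x u s y v t
  proof -
    have "K \<subseteq> {(x, u, s). 0 \<le> s + t - inner x v - inner y u}"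
      unfolding K_def
    proof (rule hull_minimal)
      show "(\<lambda>(x, u). (x, u, inner x u)) ` G \<subseteq> {(x, u, s). 0 \<le> s + t - inner x v - inner y u}"
        using half[OF _ that(2)] by (fastforce simp: algebra_simps)
      have "0 \<le> a * s + b * s' + t - inner (a *\<^sub>R x + b *\<^sub>R x') v - inner y (a *\<^sub>R u + b *\<^sub>R u')"
        if "0 \<le> s + t - inner x v - inner y u" "0 \<le> s' + t - inner x' v - inner y u'"
          "0 \<le> a" "0 \<le> b" "a + b = 1" for a b s s' x x' u u'
      proof -
        have "0 \<le> a * (s + t - inner x v - inner y u) + b * (s' + t - inner x' v - inner y u')"
          using that by simp
        also have "\<dots> = a * s + b * s' + (a + b) * t - inner (a *\<^sub>R x + b *\<^sub>R x') v - inner y (a *\<^sub>R u + b *\<^sub>R u')"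
          by (simp add: inner_simps algebra_simps)
        finally show ?thesis using that by simp
      qed
      then show "convex {(x, u, s). 0 \<le> s + t - inner x v - inner y u}"
        by (auto simp: convex_def)
    qed
    with that(1) show ?thesis by auto
  qed
  have "linear (\<lambda>(x::'a, u, t::real). (x - u, t))"
    by (intro linearI) (auto simp: algebra_simps)
  then have "convex S"
    unfolding S_def K_def by (intro convex_linear_image convex_convex_hull)
  moreover have "0 \<le> (norm z)\<^sup>2 / 4 + t" if zt: "(z, t) \<in> S" for z t
  proof -
    obtain x u where xu: "(x, u, t) \<in> K" "z = x - u" using zt by (auto simp: S_def)
    \<comment> \<open>The bilinear inequality on the diagonal.\<close>
    have "inner x u \<le> t" using full[OF xu(1) xu(1)] by simp
    moreover have "0 \<le> (norm (x + u))\<^sup>2 / 4" by simp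
    moreover have "(norm (x + u))\<^sup>2 / 4 = (norm z)\<^sup>2 / 4 + inner x u"
      unfolding xu(2) power2_norm_eq_inner
      by (simp add: inner_add_left inner_add_right inner_diff_left inner_diff_right inner_commute field_simps)
    ultimately show ?thesis by linarith
  qed
  ultimately obtain z where "\<forall>(w, t)\<in>S. 0 \<le> inner z w / 2 - (norm z)\<^sup>2 / 4 + t"
    using convex_quadratic_certificate[of S] by (elim meta_impE exE) auto
  then have z: "0 \<le> inner z w / 2 - (norm z)\<^sup>2 / 4 + t" if "(w, t) \<in> S" for w t
    using that by blast
  \<comment> \<open>With \<open>p = z / 2\<close>, the product expands term by term into the
    certificate at \<open>(x - u, inner x u)\<close>.\<close>
  have "0 \<le> inner ((1/2) *\<^sub>R z - x) (- ((1/2) *\<^sub>R z) - u)" if "(x, u) \<in> G" for x u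
  proof -
    have "(x, u, inner x u) \<in> K" unfolding K_def using that by (intro hull_inc) auto
    then have "(x - u, inner x u) \<in> S" unfolding S_def by force
    from z[OF this] show ?thesis
      unfolding power2_norm_eq_inner
      by (simp add: inner_diff_left inner_diff_right inner_commute diff_divide_distrib)
  qed
  then show ?thesis by blast
qed

text \<open>Scaling the graph by \<gamma> and shifting it by \<open>w\<close> makes the extension
  point \<open>p\<close> say that \<open>q = (w - p) / \<gamma>\<close> at \<open>p\<close> is
  monotonically related to \<open>A\<close>. Adjoining this pair keeps \<open>A\<close> monotone, so
  by maximality the pair was already there.\<close>

lemma minty:
  fixes A :: "'a::{real_inner,complete_space} \<Rightarrow> 'a set"
  assumes A: "maximally_monotone A" and "\<gamma> > 0"
  shows "\<exists>p. (w - p) /\<^sub>R \<gamma> \<in> A p"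
proof -
  have mono: "0 \<le> inner (x - y) (u - v)" if "u \<in> A x" "v \<in> A y" for x y u v
    using A that unfolding maximally_monotone_def monotone_op_def by blast
  define G where "G = {(x, \<gamma> *\<^sub>R u - w) | x u. u \<in> A x}"
  have "0 \<le> inner (x - y) (u - v)" if "(x, u) \<in> G" "(y, v) \<in> G" for x u y v
  proof -
    obtain u' v' where *: "u' \<in> A x" "v' \<in> A y" "u = \<gamma> *\<^sub>R u' - w" "v = \<gamma> *\<^sub>R v' - w"
      using \<open>(x, u) \<in> G\<close> \<open>(y, v) \<in> G\<close> by (auto simp: G_def)
    have "u - v = \<gamma> *\<^sub>R (u' - v')" unfolding *(3,4) by (simp add: scaleR_diff_right)
    then show ?thesis using mono[OF *(1,2)] \<open>\<gamma> > 0\<close> by simp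
  qed
  then obtain p where p: "\<And>x u. (x, u) \<in> G \<Longrightarrow> 0 \<le> inner (p - x) (- p - u)"
    using monotone_graph_extension_point[of G] by blast
  define q where "q = (w - p) /\<^sub>R \<gamma>"
  have pq: "0 \<le> inner (p - x) (q - u)" if "u \<in> A x" for x u
  proof -
    have "q - u = (1 / \<gamma>) *\<^sub>R (- p - (\<gamma> *\<^sub>R u - w))"
      using \<open>\<gamma> > 0\<close> by (simp add: q_def algebra_simps inverse_eq_divide)
    moreover have "0 \<le> inner (p - x) (- p - (\<gamma> *\<^sub>R u - w))"
      using that by (intro p) (auto simp: G_def)
    ultimately show ?thesis using \<open>\<gamma> > 0\<close> by simp
  qed
  define A' where "A' = A(p := insert q (A p))"
  have qp: "0 \<le> inner (x - p) (u - q)" if "u \<in> A x" for x u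
    using pq[OF that] by (simp add: inner_simps)
  have "monotone_op A'"
    using pq qp mono unfolding A'_def monotone_op_def by auto
  moreover have "A x \<subseteq> A' x" for x unfolding A'_def by auto
  ultimately have "A' = A" using A by (auto simp: maximally_monotone_def)
  then have "q \<in> A p" unfolding A'_def by (metis fun_upd_same insertI1)
  then show ?thesis unfolding q_def by blast
qed

section \<open>The scalar recursion\<close>

text \<open>With \<open>k = n + 1\<close>, the factor \<open>1 + 1/k\<close> is the ratio
  \<open>(k + 1)/k\<close>, so it disappears on passing to \<open>b n = (n + 1) * u n\<close>. What
  remains is a loss \<open>1 - L/(k(k + 1))\<close>, absorbed by the bounded weight
  \<open>w\<close>, and a noise term of order \<open>K/k\<close> whose sums are logarithmic.\<close>

lemma log_rate_recursion:
  fixes u :: "nat \<Rightarrow> real" and L K :: real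
  assumes u0: "\<And>n. 0 \<le> u n" and L0: "0 \<le> L" and K0: "0 \<le> K"
    and rec: "\<And>n. (1 + 1 / (real n + 1) - L / (real n + 1)\<^sup>2) * u (Suc n) \<le> u n + K / (real n + 1)\<^sup>2"
  shows "\<exists>C. \<forall>n\<ge>1. u n \<le> C * ln (real n + 1) / (real n + 1)"
proof -
  define b where "b n = (real n + 1) * u n" for n
  \<comment> \<open>The drop \<open>2L/k - 2L/(k + 1)\<close> is twice the loss
    \<open>L/(k(k + 1))\<close>; the surplus covers the product of the loss with \<open>2L/k\<close>
    once \<open>k >= 2L\<close>.\<close>
  define w where "w n = 1 + 2 * L / (real n + 1)" for n
  have b0: "0 \<le> b n" for n using u0 by (simp add: b_def)
  have w1: "1 \<le> w n" for n using L0 by (simp add: w_def)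
  obtain N :: nat where N: "2 * L \<le> real N" using real_arch_simple by blast
  \<comment> \<open>The 4 is the bound \<open>w n <= 2\<close> times the 2 of
    \<open>reciprocal_le_ln_diff\<close>.\<close>
  have step_le: "w (Suc n) * b (Suc n) - 4 * K * ln (real (Suc n) + 1) \<le> w n * b n - 4 * K * ln (real n + 1)"
    if "n \<ge> N" for n
  proof -
    define k where "k = real n + 1"
    have k: "k \<ge> 1" "2 * L \<le> k" using that N by (auto simp: k_def)
    have "k * ((1 + 1 / k - L / k\<^sup>2) * u (Suc n)) \<le> k * (u n + K / k\<^sup>2)"
      using rec[of n] k by (intro mult_left_mono) (auto simp: k_def)
    moreover have "k * ((1 + 1 / k - L / k\<^sup>2) * u (Suc n)) = (1 - L / (k * (k + 1))) * b (Suc n)"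
    proof -
      have "b (Suc n) = (k + 1) * u (Suc n)" by (simp add: b_def k_def)
      moreover have "k * (1 + 1 / k - L / k\<^sup>2) = (1 - L / (k * (k + 1))) * (k + 1)"
        using k by (simp add: divide_simps power2_eq_square)
      ultimately show ?thesis by (simp only: mult.assoc[symmetric])
    qed
    moreover have "k * (u n + K / k\<^sup>2) = b n + K / k"
    proof -
      have b: "b n = k * u n" by (simp add: b_def k_def)
      show ?thesis using k unfolding b by (simp add: power2_eq_square distrib_left)
    qed
    ultimately have bb: "(1 - L / (k * (k + 1))) * b (Suc n) \<le> b n + K / k" by simp
    have "w n * (1 - L / (k * (k + 1))) - w (Suc n) = L * (k - 2 * L) / (k\<^sup>2 * (k + 1))"
    proof -
      have w: "w n = 1 + 2 * L / k" "w (Suc n) = 1 + 2 * L / (k + 1)" by (simp_all add: w_def k_def)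
      show ?thesis using k unfolding w
        by (simp add: divide_simps power2_eq_square) (simp only: algebra_simps)
    qed
    moreover have "0 \<le> L * (k - 2 * L) / (k\<^sup>2 * (k + 1))" using k L0 by simp
    ultimately have ww: "w (Suc n) \<le> w n * (1 - L / (k * (k + 1)))" by linarith
    have "w (Suc n) * b (Suc n) \<le> w n * ((1 - L / (k * (k + 1))) * b (Suc n))"
      using mult_right_mono[OF ww b0[of "Suc n"]] by (simp add: mult.assoc)
    also have "\<dots> \<le> w n * (b n + K / k)"
      using bb w1[of n] by (intro mult_left_mono) auto
    also have "\<dots> \<le> w n * b n + 2 * (K / k)"
    proof -
      have "w n \<le> 2" using k by (simp add: w_def k_def[symmetric])
      moreover have "0 \<le> K / k" using K0 k by simp
      ultimately show ?thesis by (simp only: distrib_left) (intro add_left_mono mult_right_mono)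
    qed
    also have "2 * (K / k) \<le> 2 * K * (2 * (ln (k + 1) - ln k))"
      using mult_left_mono[OF reciprocal_le_ln_diff[OF k(1)], of "2 * K"] K0 by simp
    finally show ?thesis by (simp add: k_def algebra_simps)
  qed
  \<comment> \<open>The absolute value bounds the telescoped quantity at its start \<open>N\<close>;
    the sum dominates every \<open>b n\<close> up to \<open>N\<close>.\<close>
  define D where "D = \<bar>w N * b N - 4 * K * ln (real N + 1)\<bar> + (\<Sum>n\<le>N. b n)"
  have D0: "0 \<le> D" unfolding D_def using b0 by (simp add: sum_nonneg)
  have bound: "b n \<le> D + 4 * K * ln (real n + 1)" for n
  proof (cases "n \<le> N")
    case True
    then have "b n \<le> (\<Sum>n\<le>N. b n)" using b0 by (intro member_le_sum) auto
    moreover have "0 \<le> K * ln (real n + 1)" using K0 by simp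
    ultimately show ?thesis by (simp add: D_def)
  next
    case False
    from False have "N \<le> n" by simp
    then have "w n * b n - 4 * K * ln (real n + 1) \<le> w N * b N - 4 * K * ln (real N + 1)"
    proof (induction n rule: dec_induct)
      case (step n)
      then show ?case using step_le[of n] by linarith
    qed simp
    moreover have "b n \<le> w n * b n" using mult_right_mono[OF w1 b0] by simp
    moreover have "0 \<le> (\<Sum>n\<le>N. b n)" using b0 by (simp add: sum_nonneg)
    ultimately show ?thesis unfolding D_def by linarith
  qed
  \<comment> \<open>The right-hand side vanishes at \<open>n = 0\<close>; from \<open>n = 1\<close>
    on, the logarithm is at least \<open>ln 2\<close> and absorbs the constant
    \<open>D\<close>.\<close>
  have "u n \<le> (D / ln 2 + 4 * K) * ln (real n + 1) / (real n + 1)" if "n \<ge> 1" for n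
  proof -
    have "ln 2 \<le> ln (real n + 1)" using that by simp
    then have "D * ln 2 \<le> D * ln (real n + 1)" using D0 by (rule mult_left_mono)
    then have "D \<le> D / ln 2 * ln (real n + 1)" by (simp add: field_simps)
    then have "(real n + 1) * u n \<le> (D / ln 2 + 4 * K) * ln (real n + 1)"
      using bound[of n] by (simp add: b_def distrib_right)
    then show ?thesis by (subst pos_le_divide_eq) (auto simp: mult.commute)
  qed
  then show ?thesis by blast
qed

section \<open>The resolvent\<close>

text \<open>Justifies the definite description: existence is Minty's theorem, and for two solutions
  \<open>p\<close>, \<open>q\<close> monotonicity makes \<open>- |q - p|^2 / \<gamma>\<close>
  nonnegative.\<close>

lemma resolvent_mem:
  fixes A :: "'a::{real_inner,complete_space} \<Rightarrow> 'a set"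
  assumes A: "maximally_monotone A" and "\<gamma> > 0"
  shows "(w - resolvent \<gamma> A w) /\<^sub>R \<gamma> \<in> A (resolvent \<gamma> A w)"
proof -
  have mono: "0 \<le> inner (x - y) (u - v)" if "u \<in> A x" "v \<in> A y" for x y u v
    using A that unfolding maximally_monotone_def monotone_op_def by blast
  have iff: "w \<in> (\<lambda>u. p + \<gamma> *\<^sub>R u) ` A p \<longleftrightarrow> (w - p) /\<^sub>R \<gamma> \<in> A p" for p
  proof
    assume "(w - p) /\<^sub>R \<gamma> \<in> A p"
    then show "w \<in> (\<lambda>u. p + \<gamma> *\<^sub>R u) ` A p" using \<open>\<gamma> > 0\<close> by (auto intro!: image_eqI)
  qed (use \<open>\<gamma> > 0\<close> in auto)
  obtain p where p: "(w - p) /\<^sub>R \<gamma> \<in> A p" using minty[OF assms] by blast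
  have "resolvent \<gamma> A w = p"
    unfolding resolvent_def iff
  proof (rule the_equality)
    show "(w - p) /\<^sub>R \<gamma> \<in> A p" by (rule p)
  next
    fix q assume "(w - q) /\<^sub>R \<gamma> \<in> A q"
    from mono[OF this p] have "0 \<le> inner (q - p) ((w - q) /\<^sub>R \<gamma> - (w - p) /\<^sub>R \<gamma>)" .
    also have "(w - q) /\<^sub>R \<gamma> - (w - p) /\<^sub>R \<gamma> = - ((1 / \<gamma>) *\<^sub>R (q - p))"
      by (simp add: algebra_simps inverse_eq_divide)
    finally have "(norm (q - p))\<^sup>2 \<le> 0"
      unfolding power2_norm_eq_inner using \<open>\<gamma> > 0\<close> by (simp add: divide_le_0_iff)
    then show "q = p" by simp
  qed
  then show ?thesis using p by simp
qed

text \<open>Monotonicity gives firm nonexpansiveness, and Cauchy-Schwarz weakens it. The Lipschitz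
  bound makes the next iterate measurable and keeps it square integrable.\<close>

lemma resolvent_nonexpansive:
  fixes A :: "'a::{real_inner,complete_space} \<Rightarrow> 'a set"
  assumes "maximally_monotone A" and "\<gamma> > 0"
  shows "norm (resolvent \<gamma> A v - resolvent \<gamma> A w) \<le> norm (v - w)"
proof -
  define p q where "p = resolvent \<gamma> A v" and "q = resolvent \<gamma> A w"
  have "(v - p) /\<^sub>R \<gamma> \<in> A p" "(w - q) /\<^sub>R \<gamma> \<in> A q"
    unfolding p_def q_def by (rule resolvent_mem[OF assms])+
  then have "0 \<le> inner (p - q) ((v - p) /\<^sub>R \<gamma> - (w - q) /\<^sub>R \<gamma>)"
    using assms(1) unfolding maximally_monotone_def monotone_op_def by blast
  also have "(v - p) /\<^sub>R \<gamma> - (w - q) /\<^sub>R \<gamma> = (1 / \<gamma>) *\<^sub>R ((v - w) - (p - q))"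
    by (simp add: algebra_simps inverse_eq_divide)
  finally have "0 \<le> inner (p - q) ((v - w) - (p - q))"
    using \<open>\<gamma> > 0\<close> by (simp add: zero_le_divide_iff)
  then have "(norm (p - q))\<^sup>2 \<le> inner (p - q) (v - w)"
    by (simp add: inner_diff_right power2_norm_eq_inner)
  also have "\<dots> \<le> norm (p - q) * norm (v - w)" by (rule norm_cauchy_schwarz)
  finally have "norm (p - q) \<le> norm (v - w)"
    by (cases "p = q") (simp_all add: power2_eq_square)
  then show ?thesis by (simp only: p_def q_def)
qed

section \<open>Filtration and conditional expectation\<close>

lemma measurable_nat_filtration:
  fixes x :: "nat \<Rightarrow> 'w \<Rightarrow> 'a::topological_space"
  assumes "k \<le> n"
  shows "x k \<in> borel_measurable (nat_filtration M x n)"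
proof (rule measurableI)
  have sub: "(\<Union>k\<in>{..n}. (\<lambda>U. x k -` U \<inter> space M) ` sets borel) \<subseteq> Pow (space M)" by auto
  fix U :: "'a set" assume "U \<in> sets borel"
  then have "x k -` U \<inter> space M \<in> (\<Union>k\<in>{..n}. (\<lambda>U. x k -` U \<inter> space M) ` sets borel)"
    using assms by blast
  then show "x k -` U \<inter> space (nat_filtration M x n) \<in> sets (nat_filtration M x n)"
    unfolding nat_filtration_def sets_measure_of[OF sub] space_measure_of[OF sub]
    by (rule sigma_sets.Basic)
qed simp

lemma subalgebra_nat_filtration:
  assumes "\<And>k. k \<le> n \<Longrightarrow> x k \<in> borel_measurable M"
  shows "subalgebra M (nat_filtration M x n)"
proof -
  have sub: "(\<Union>k\<in>{..n}. (\<lambda>U. x k -` U \<inter> space M) ` sets borel) \<subseteq> Pow (space M)" by auto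
  show ?thesis
    unfolding subalgebra_def nat_filtration_def sets_measure_of[OF sub] space_measure_of[OF sub]
    using assms by (auto intro!: sets.sigma_sets_subset measurable_sets)
qed

text \<open>\<open>is_cond_exp\<close> tests only against sets of \<open>F\<close>. Linearity
  extends this to \<open>F\<close>-simple vector functions and dominated convergence to
  \<open>W\<close>; the product of norms, not \<open>W\<close> alone, has to be integrable.\<close>

lemma is_cond_exp_inner_eq_0:
  fixes X Z W :: "'w \<Rightarrow> 'a::{real_inner,banach,second_countable_topology}"
  assumes sub: "subalgebra M F" and ce: "is_cond_exp M F X Z"
    and Z: "Z \<in> borel_measurable M"
    and W: "W \<in> borel_measurable F"
    and int: "integrable M (\<lambda>\<omega>. norm (W \<omega>) * norm (X \<omega> - Z \<omega>))"
  shows "(\<integral>\<omega>. inner (W \<omega>) (X \<omega> - Z \<omega>) \<partial>M) = 0"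
proof -
  obtain Z' where X: "integrable M X" and Z': "integrable M Z'" and ae: "AE \<omega> in M. Z' \<omega> = Z \<omega>"
    and eq: "\<And>S. S \<in> sets F \<Longrightarrow> set_lebesgue_integral M S X = set_lebesgue_integral M S Z'"
    using ce by (auto simp: is_cond_exp_def)
  define e where "e \<omega> = X \<omega> - Z \<omega>" for \<omega>
  have space: "space F = space M" and sets: "sets F \<subseteq> sets M"
    using sub by (auto simp: subalgebra_def)
  have Zint: "integrable M Z"
    using Z' ae Z by (subst integrable_cong_AE[of _ _ Z']) auto
  then have e: "integrable M e" using X unfolding e_def by auto
  note [measurable] = borel_measurable_integrable[OF X] borel_measurable_integrable[OF Z'] Z
    borel_measurable_integrable[OF e] measurable_from_subalg[OF sub W]
  have e0: "(\<integral>\<omega>. indicator S \<omega> *\<^sub>R e \<omega> \<partial>M) = 0" if S: "S \<in> sets F" for S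
  proof -
    have [measurable]: "S \<in> sets M" using S sets by auto
    have "(\<integral>\<omega>. indicator S \<omega> *\<^sub>R e \<omega> \<partial>M) = (\<integral>\<omega>. indicator S \<omega> *\<^sub>R X \<omega> - indicator S \<omega> *\<^sub>R Z' \<omega> \<partial>M)"
      using ae by (intro integral_cong_AE) (auto simp: e_def scaleR_diff_right)
    also have "\<dots> = (\<integral>\<omega>. indicator S \<omega> *\<^sub>R X \<omega> \<partial>M) - (\<integral>\<omega>. indicator S \<omega> *\<^sub>R Z' \<omega> \<partial>M)"
      using X Z' by (intro Bochner_Integration.integral_diff integrable_mult_indicator) auto
    finally show ?thesis using eq[OF S] by (simp add: set_lebesgue_integral_def)
  qed
  \<comment> \<open>Approximation relative to the centre 0, which yields the bound
    \<open>2 * norm (W \<omega>)\<close> and hence the integrable majorant.\<close>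
  obtain s where s: "\<And>i. simple_function F (s i)"
    and lim: "\<And>\<omega>. \<omega> \<in> space F \<Longrightarrow> (\<lambda>i. s i \<omega>) \<longlonglongrightarrow> W \<omega>"
    and bound: "\<And>i \<omega>. \<omega> \<in> space F \<Longrightarrow> norm (s i \<omega>) \<le> 2 * norm (W \<omega>)"
    using borel_measurable_implies_sequence_metric[OF W, of 0] by (simp add: dist_norm) blast
  \<comment> \<open>Splitting over the finitely many values of \<open>s i\<close> moves each value
    out of the integral and leaves \<open>e0\<close> on its preimage.\<close>
  have simple: "(\<integral>\<omega>. inner (s i \<omega>) (e \<omega>) \<partial>M) = 0" for i
  proof -
    have fin: "finite (s i ` space F)" using s by (auto simp: simple_function_def)
    have pre: "s i -` {y} \<inter> space F \<in> sets F" if "y \<in> s i ` space F" for y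
      using s that by (auto simp: simple_function_def)
    have int_e: "integrable M (\<lambda>\<omega>. indicator (s i -` {y} \<inter> space F) \<omega> *\<^sub>R e \<omega>)"
      if "y \<in> s i ` space F" for y
      using pre[OF that] sets e by (intro integrable_mult_indicator) auto
    have "(\<integral>\<omega>. inner (s i \<omega>) (e \<omega>) \<partial>M)
        = (\<integral>\<omega>. (\<Sum>y\<in>s i ` space F. inner y (indicator (s i -` {y} \<inter> space F) \<omega> *\<^sub>R e \<omega>)) \<partial>M)"
    proof (rule Bochner_Integration.integral_cong[OF refl])
      fix \<omega> assume "\<omega> \<in> space M"
      then have "(\<Sum>y\<in>s i ` space F. inner y (indicator (s i -` {y} \<inter> space F) \<omega> *\<^sub>R e \<omega>))
          = (\<Sum>y\<in>s i ` space F. if y = s i \<omega> then inner y (e \<omega>) else 0)"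
        by (intro sum.cong) (auto simp: space indicator_def)
      also have "\<dots> = inner (s i \<omega>) (e \<omega>)"
        using fin \<open>\<omega> \<in> space M\<close> by (simp add: space)
      finally show "inner (s i \<omega>) (e \<omega>)
          = (\<Sum>y\<in>s i ` space F. inner y (indicator (s i -` {y} \<inter> space F) \<omega> *\<^sub>R e \<omega>))" ..
    qed
    also have "\<dots> = (\<Sum>y\<in>s i ` space F. \<integral>\<omega>. inner y (indicator (s i -` {y} \<inter> space F) \<omega> *\<^sub>R e \<omega>) \<partial>M)"
      by (intro Bochner_Integration.integral_sum integrable_inner_right int_e)
    also have "\<dots> = (\<Sum>y\<in>s i ` space F. inner y (\<integral>\<omega>. indicator (s i -` {y} \<inter> space F) \<omega> *\<^sub>R e \<omega> \<partial>M))"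
      by (intro sum.cong refl integral_inner_right int_e)
    also have "\<dots> = 0" using e0[OF pre] by simp
    finally show ?thesis .
  qed
  have "(\<lambda>i. \<integral>\<omega>. inner (s i \<omega>) (e \<omega>) \<partial>M) \<longlonglongrightarrow> (\<integral>\<omega>. inner (W \<omega>) (e \<omega>) \<partial>M)"
  proof (rule integral_dominated_convergence)
    show "integrable M (\<lambda>\<omega>. 2 * (norm (W \<omega>) * norm (e \<omega>)))"
      using int by (simp add: e_def)
    show "(\<lambda>\<omega>. inner (s i \<omega>) (e \<omega>)) \<in> borel_measurable M" for i
      using measurable_from_subalg[OF sub borel_measurable_simple_function[OF s]] by measurable
    show "AE \<omega> in M. (\<lambda>i. inner (s i \<omega>) (e \<omega>)) \<longlonglongrightarrow> inner (W \<omega>) (e \<omega>)"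
      using lim by (intro AE_I2 tendsto_inner tendsto_const) (simp add: space)
    show "AE \<omega> in M. norm (inner (s i \<omega>) (e \<omega>)) \<le> 2 * (norm (W \<omega>) * norm (e \<omega>))" for i
    proof (rule AE_I2)
      fix \<omega> assume "\<omega> \<in> space M"
      have "norm (inner (s i \<omega>) (e \<omega>)) \<le> norm (s i \<omega>) * norm (e \<omega>)"
        using Cauchy_Schwarz_ineq2 by simp
      also have "\<dots> \<le> 2 * norm (W \<omega>) * norm (e \<omega>)"
        using bound \<open>\<omega> \<in> space M\<close> by (intro mult_right_mono) (auto simp: space)
      finally show "norm (inner (s i \<omega>) (e \<omega>)) \<le> 2 * (norm (W \<omega>) * norm (e \<omega>))" by simp
    qed
  qed measurable
  then have "(\<integral>\<omega>. inner (W \<omega>) (e \<omega>) \<partial>M) = 0" by (simp add: simple LIMSEQ_const_iff)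
  then show ?thesis by (simp add: e_def)
qed

section \<open>Square-integrable random vectors\<close>

definition square_integrable :: "'w measure \<Rightarrow> ('w \<Rightarrow> 'a::{real_inner,second_countable_topology}) \<Rightarrow> bool" where
  "square_integrable M f \<longleftrightarrow> f \<in> borel_measurable M \<and> integrable M (\<lambda>\<omega>. (norm (f \<omega>))\<^sup>2)"

text \<open>The conditional expectation is an extended nonnegative one, so integrability is a
  conclusion: integrating the bound over total mass 1 makes the second moment finite.
  \<open>max c 0\<close> appears because \<open>ennreal\<close> sends negative \<open>c\<close> to
  0.\<close>

lemma nn_cond_exp_square_bound:
  assumes M: "prob_space M" and sub: "subalgebra M F" and f: "f \<in> borel_measurable M"
    and bd: "AE \<omega> in M. nn_cond_exp M F (\<lambda>\<omega>. ennreal ((norm (f \<omega>))\<^sup>2)) \<omega> \<le> ennreal c"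
  shows "square_integrable M f" and "(\<integral>\<omega>. (norm (f \<omega>))\<^sup>2 \<partial>M) \<le> max c 0"
proof -
  have "finite_measure_subalgebra M F"
    using M sub by (intro finite_measure_subalgebra.intro finite_measure_subalgebra_axioms.intro prob_space.axioms)
  then have sf: "sigma_finite_subalgebra M F" by (rule finite_measure_subalgebra_is_sigma_finite)
  note [measurable] = f
  have "(\<integral>\<^sup>+ \<omega>. ennreal ((norm (f \<omega>))\<^sup>2) \<partial>M)
      = (\<integral>\<^sup>+ \<omega>. nn_cond_exp M F (\<lambda>\<omega>. ennreal ((norm (f \<omega>))\<^sup>2)) \<omega> \<partial>M)"
    using sigma_finite_subalgebra.nn_cond_exp_intg[OF sf, of "\<lambda>_. 1" "\<lambda>\<omega>. ennreal ((norm (f \<omega>))\<^sup>2)"] by simp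
  also have "\<dots> \<le> (\<integral>\<^sup>+ \<omega>. ennreal c \<partial>M)" by (rule nn_integral_mono_AE[OF bd])
  also have "\<dots> = ennreal (max c 0)"
    by (simp add: prob_space.emeasure_space_1[OF M] max_def ennreal_neg)
  finally have le: "(\<integral>\<^sup>+ \<omega>. ennreal ((norm (f \<omega>))\<^sup>2) \<partial>M) \<le> ennreal (max c 0)" .
  have "integrable M (\<lambda>\<omega>. (norm (f \<omega>))\<^sup>2)"
    using le by (intro integrableI_bounded) (auto simp: top_unique less_top[symmetric])
  then show "square_integrable M f" using f by (simp add: square_integrable_def)
  show "(\<integral>\<omega>. (norm (f \<omega>))\<^sup>2 \<partial>M) \<le> max c 0"
    using le by (intro integral_real_bounded) auto
qed

lemma square_integrable_diff:
  assumes "square_integrable M f" "square_integrable M g"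
  shows "square_integrable M (\<lambda>\<omega>. f \<omega> - g \<omega>)"
  unfolding square_integrable_def
proof
  have [measurable]: "f \<in> borel_measurable M" "g \<in> borel_measurable M"
    using assms by (auto simp: square_integrable_def)
  show "(\<lambda>\<omega>. f \<omega> - g \<omega>) \<in> borel_measurable M" by measurable
  show "integrable M (\<lambda>\<omega>. (norm (f \<omega> - g \<omega>))\<^sup>2)"
  proof (rule Bochner_Integration.integrable_bound)
    show "integrable M (\<lambda>\<omega>. 2 * (norm (f \<omega>))\<^sup>2 + 2 * (norm (g \<omega>))\<^sup>2)"
      using assms by (auto simp: square_integrable_def)
    show "AE \<omega> in M. norm ((norm (f \<omega> - g \<omega>))\<^sup>2) \<le> norm (2 * (norm (f \<omega>))\<^sup>2 + 2 * (norm (g \<omega>))\<^sup>2)"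
      using power2_norm_diff_le by (auto intro!: AE_I2)
  qed measurable
qed

lemma square_integrable_scaleR:
  "square_integrable M f \<Longrightarrow> square_integrable M (\<lambda>\<omega>. c *\<^sub>R f \<omega>)"
  by (auto simp: square_integrable_def power_mult_distrib)

lemma square_integrable_const:
  "finite_measure M \<Longrightarrow> square_integrable M (\<lambda>\<omega>. c)"
  by (simp add: square_integrable_def finite_measure.integrable_const)

lemma square_integrable_add:
  assumes "square_integrable M f" "square_integrable M g"
  shows "square_integrable M (\<lambda>\<omega>. f \<omega> + g \<omega>)"
  using square_integrable_diff[OF assms(1) square_integrable_scaleR[OF assms(2), of "-1"]] by simp

lemma lipschitz_fun_borel_measurable:
  fixes f :: "'a::real_normed_vector \<Rightarrow> 'a"
  assumes "lipschitz_fun L f"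
  shows "f \<in> borel_measurable borel"
proof (rule borel_measurable_continuous_onI, rule lipschitz_on_continuous_on)
  show "\<bar>L\<bar>-lipschitz_on UNIV f"
  proof (rule lipschitz_onI)
    fix x y
    have "norm (f x - f y) \<le> L * norm (x - y)" using assms by (simp add: lipschitz_fun_def)
    also have "\<dots> \<le> \<bar>L\<bar> * norm (x - y)" by (intro mult_right_mono) auto
    finally show "dist (f x) (f y) \<le> \<bar>L\<bar> * dist x y" by (simp add: dist_norm)
  qed simp
qed

text \<open>A Lipschitz map grows at most linearly away from \<open>f 0\<close>, and constants are
  square integrable for a finite measure. Serves both \<open>B\<close> and the resolvents.\<close>

lemma square_integrable_lipschitz:
  fixes f :: "'a::{real_inner,second_countable_topology} \<Rightarrow> 'a"
  assumes "finite_measure M" and lip: "lipschitz_fun L f" and g: "square_integrable M g"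
  shows "square_integrable M (\<lambda>\<omega>. f (g \<omega>))"
proof -
  have [measurable]: "f \<in> borel_measurable borel" "g \<in> borel_measurable M"
    using lipschitz_fun_borel_measurable[OF lip] g by (auto simp: square_integrable_def)
  have "square_integrable M (\<lambda>\<omega>. f (g \<omega>) - f 0)"
    unfolding square_integrable_def
  proof
    show "(\<lambda>\<omega>. f (g \<omega>) - f 0) \<in> borel_measurable M" by measurable
    show "integrable M (\<lambda>\<omega>. (norm (f (g \<omega>) - f 0))\<^sup>2)"
    proof (rule Bochner_Integration.integrable_bound)
      show "integrable M (\<lambda>\<omega>. L\<^sup>2 * (norm (g \<omega>))\<^sup>2)"
        using g by (auto simp: square_integrable_def)
      have "(norm (f (g \<omega>) - f 0))\<^sup>2 \<le> L\<^sup>2 * (norm (g \<omega>))\<^sup>2" for \<omega>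
      proof -
        have "norm (f (g \<omega>) - f 0) \<le> L * norm (g \<omega> - 0)"
          using lip unfolding lipschitz_fun_def by blast
        from power_mono[OF this, of 2] show ?thesis by (simp add: power_mult_distrib)
      qed
      then show "AE \<omega> in M. norm ((norm (f (g \<omega>) - f 0))\<^sup>2) \<le> norm (L\<^sup>2 * (norm (g \<omega>))\<^sup>2)"
        by (auto intro!: AE_I2)
    qed measurable
  qed
  from square_integrable_add[OF this square_integrable_const[OF assms(1), of "f 0"]] show ?thesis by simp
qed

lemma square_integrable_norm_mult:
  assumes "square_integrable M f" "square_integrable M g"
  shows "integrable M (\<lambda>\<omega>. norm (f \<omega>) * norm (g \<omega>))"
proof -
  have [measurable]: "f \<in> borel_measurable M" "g \<in> borel_measurable M"
    using assms by (auto simp: square_integrable_def)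
  show ?thesis
  proof (rule Bochner_Integration.integrable_bound)
    show "integrable M (\<lambda>\<omega>. (norm (f \<omega>))\<^sup>2 + (norm (g \<omega>))\<^sup>2)"
      using assms by (auto simp: square_integrable_def)
    have "a * b \<le> a\<^sup>2 + b\<^sup>2" if "0 \<le> a" "0 \<le> b" for a b :: real
      using that sum_squares_bound[of a b] mult_nonneg_nonneg[OF that] by linarith
    then show "AE \<omega> in M. norm (norm (f \<omega>) * norm (g \<omega>)) \<le> norm ((norm (f \<omega>))\<^sup>2 + (norm (g \<omega>))\<^sup>2)"
      by (auto intro!: AE_I2)
  qed measurable
qed

lemma square_integrable_inner:
  assumes "square_integrable M f" "square_integrable M g"
  shows "integrable M (\<lambda>\<omega>. inner (f \<omega>) (g \<omega>))"
proof -
  have [measurable]: "f \<in> borel_measurable M" "g \<in> borel_measurable M"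
    using assms by (auto simp: square_integrable_def)
  show ?thesis
    by (rule Bochner_Integration.integrable_bound[OF square_integrable_norm_mult[OF assms]])
      (auto intro!: AE_I2 Cauchy_Schwarz_ineq2)
qed

section \<open>The convergence rate\<close>

theorem mainTheorem7:
  fixes M :: "'w measure"
    and A :: "'a::{real_inner, banach, second_countable_topology} \<Rightarrow> 'a set"
    and B :: "'a \<Rightarrow> 'a"
    and \<mu> \<nu> c :: real
    and xbar :: 'a
    and xm :: "'w \<Rightarrow> 'a"
    and x r :: "nat \<Rightarrow> 'w \<Rightarrow> 'a"
    and \<gamma> :: "nat \<Rightarrow> real"
  assumes M: "prob_space M"
    and A_max: "maximally_monotone A"
    and B_mono: "monotone_fun B"
    and mu_pos: "\<mu> > 0"
    and B_lip: "lipschitz_fun \<mu> B"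
    and nu_pos: "\<nu> > 0"
    and A_strong: "strongly_monotone \<nu> A"
    and xbar: "xbar \<in> zer_sum A B"
    and gamma: "\<And>n. \<gamma> n = 1 / (2 * \<nu> * (real n + 1))"
    and x0_meas: "x 0 \<in> borel_measurable M"
    and xm_meas: "xm \<in> borel_measurable M"
    and x0_sq: "integrable M (\<lambda>\<omega>. (norm (x 0 \<omega>))\<^sup>2)"
    and xm_sq: "integrable M (\<lambda>\<omega>. (norm (xm \<omega>))\<^sup>2)"
    and r_meas: "\<And>n. r n \<in> borel_measurable M"
    and r_cond: "\<And>n. is_cond_exp M (nat_filtration M x n) (r n) (\<lambda>\<omega>. B (refl_pt xm x n \<omega>))"
    and iter: "\<And>n \<omega>. \<omega> \<in> space M \<Longrightarrow>
                 x (Suc n) \<omega> = resolvent (\<gamma> n) A (x n \<omega> - \<gamma> n *\<^sub>R r n \<omega>)"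
    and var_bd: "\<And>n. AE \<omega> in M.
                 nn_cond_exp M (nat_filtration M x n)
                   (\<lambda>\<omega>. ennreal ((norm (r n \<omega> - B (refl_pt xm x n \<omega>)))\<^sup>2)) \<omega> \<le> ennreal c"
  shows "\<exists>C. \<forall>n. n > (LEAST n0::nat. real n0 > 4 * \<mu> * (1 + sqrt 2) / \<nu>) \<longrightarrow>
            (\<integral>\<^sup>+ \<omega>. ennreal ((norm (x n \<omega> - xbar))\<^sup>2) \<partial>M)
              \<le> ennreal (C * ln (real n + 1) / (real n + 1))"
proof -
  have fin: "finite_measure M" using M by (rule prob_space.axioms)
  define y where "y n \<omega> = refl_pt xm x n \<omega>" for n \<omega>
  \<comment> \<open>The previous iterate; the case split keeps the truncated \<open>0 - 1\<close>
    from replacing \<open>xm\<close> by \<open>x 0\<close>.\<close>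
  define xp where "xp n = (if n = 0 then xm else x (n - 1))" for n
  define e where "e n \<omega> = r n \<omega> - B (y n \<omega>)" for n \<omega>
  have y_eq: "y n \<omega> = 2 *\<^sub>R x n \<omega> - xp n \<omega>" for n \<omega>
    by (simp add: y_def refl_pt_def xp_def)
  have gpos: "\<gamma> n > 0" for n using nu_pos by (simp add: gamma)
  have res_lip: "lipschitz_fun 1 (resolvent (\<gamma> n) A)" for n
    using resolvent_nonexpansive[OF A_max gpos] by (simp add: lipschitz_fun_def)
  \<comment> \<open>Stated conditionally on the vectors up to time \<open>n\<close>, because the
    induction establishing their square integrability uses it.\<close>
  have noise: "square_integrable M (e n)" "(\<integral>\<omega>. (norm (e n \<omega>))\<^sup>2 \<partial>M) \<le> max c 0"
    if x: "\<And>k. k \<le> n \<Longrightarrow> square_integrable M (x k)" and xp: "square_integrable M (xp n)" for n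
  proof -
    have sub: "subalgebra M (nat_filtration M x n)"
      using x by (intro subalgebra_nat_filtration) (auto simp: square_integrable_def)
    have "square_integrable M (\<lambda>\<omega>. B (y n \<omega>))"
      unfolding y_eq
      by (intro square_integrable_lipschitz[OF fin B_lip] square_integrable_diff square_integrable_scaleR x xp) simp
    then have [measurable]: "e n \<in> borel_measurable M"
      using r_meas[of n] unfolding e_def by (auto simp: square_integrable_def)
    show "square_integrable M (e n)" "(\<integral>\<omega>. (norm (e n \<omega>))\<^sup>2 \<partial>M) \<le> max c 0"
      using nn_cond_exp_square_bound[OF M sub, of "e n" c] var_bd[of n] by (simp_all add: e_def y_def)
  qed
  have x_sq: "square_integrable M (x n)" for n
  proof (induction n rule: less_induct)
    case (less n)
    show ?case
    proof (cases n)
      case 0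
      then show ?thesis using x0_meas x0_sq by (simp add: square_integrable_def)
    next
      case (Suc m)
      have x: "square_integrable M (x k)" if "k \<le> m" for k using that less Suc by simp
      have xp: "square_integrable M (xp m)"
        using x xm_meas xm_sq by (auto simp: xp_def square_integrable_def)
      \<comment> \<open>Writing \<open>r m\<close> as \<open>e m + B (y m)\<close> reduces its
        second moment to the variance bound and the Lipschitz growth of \<open>B\<close>.\<close>
      have "square_integrable M (\<lambda>\<omega>. resolvent (\<gamma> m) A (x m \<omega> - \<gamma> m *\<^sub>R (e m \<omega> + B (y m \<omega>))))"
        unfolding y_eq
        by (intro square_integrable_lipschitz[OF fin res_lip] square_integrable_lipschitz[OF fin B_lip]
            square_integrable_diff square_integrable_scaleR square_integrable_add x xp noise) simp_all
      moreover have "x n \<omega> = resolvent (\<gamma> m) A (x m \<omega> - \<gamma> m *\<^sub>R (e m \<omega> + B (y m \<omega>)))"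
        if "\<omega> \<in> space M" for \<omega>
        using iter[OF that] by (simp add: Suc e_def)
      ultimately show ?thesis
        unfolding square_integrable_def by (simp cong: measurable_cong Bochner_Integration.integrable_cong)
    qed
  qed
  have xp_sq: "square_integrable M (xp n)" for n
    using x_sq xm_meas xm_sq by (auto simp: xp_def square_integrable_def)
  note e_sq = noise(1)[OF x_sq xp_sq] and e_bd = noise(2)[OF x_sq xp_sq]
  define W where "W n \<omega> = x n \<omega> - xbar" for n \<omega>
  define D where "D n \<omega> = x n \<omega> - xp n \<omega>" for n \<omega>
  have W_sq: "square_integrable M (W n)" for n
    unfolding W_def by (intro square_integrable_diff x_sq square_integrable_const[OF fin])
  have D_sq: "square_integrable M (D n)" for n
    unfolding D_def by (intro square_integrable_diff x_sq xp_sq)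
  have [simp]: "integrable M (\<lambda>\<omega>. (norm (W n \<omega>))\<^sup>2)" "integrable M (\<lambda>\<omega>. (norm (D n \<omega>))\<^sup>2)"
    "integrable M (\<lambda>\<omega>. (norm (e n \<omega>))\<^sup>2)" "integrable M (\<lambda>\<omega>. inner (W n \<omega>) (e n \<omega>))" for n
    using W_sq D_sq e_sq square_integrable_inner[OF W_sq e_sq] by (auto simp: square_integrable_def)
  have orth: "(\<integral>\<omega>. inner (W n \<omega>) (e n \<omega>) \<partial>M) = 0" for n
    unfolding e_def y_def
  proof (rule is_cond_exp_inner_eq_0[OF _ r_cond])
    show "subalgebra M (nat_filtration M x n)"
      using x_sq by (intro subalgebra_nat_filtration) (auto simp: square_integrable_def)
    show "W n \<in> borel_measurable (nat_filtration M x n)"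
      unfolding W_def using measurable_nat_filtration[of n n x M] by measurable
    show "integrable M (\<lambda>\<omega>. norm (W n \<omega>) * norm (r n \<omega> - B (refl_pt xm x n \<omega>)))"
      using square_integrable_norm_mult[OF W_sq e_sq] by (simp add: e_def y_def)
    have "(\<lambda>\<omega>. r n \<omega> - e n \<omega>) \<in> borel_measurable M"
      using r_meas e_sq[of n] by (auto simp: square_integrable_def)
    then show "(\<lambda>\<omega>. B (refl_pt xm x n \<omega>)) \<in> borel_measurable M"
      by (simp add: e_def y_def)
  qed
  define a where "a n = (\<integral>\<omega>. (norm (W n \<omega>))\<^sup>2 \<partial>M)" for n
  define d where "d n = (\<integral>\<omega>. (norm (D n \<omega>))\<^sup>2 \<partial>M)" for n
  \<comment> \<open>Since \<open>\<gamma> n = 1 / (2 * \<nu> * k)\<close>, the gain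
    \<open>2 * \<nu> * \<gamma> n\<close> is exactly \<open>1 / k\<close>, the loss
    \<open>16 \<gamma>^2 \<mu>^2\<close> is \<open>L / k^2\<close>, and the noise
    \<open>2 \<gamma>^2 max c 0\<close> is \<open>K / k^2\<close>.\<close>
  define L where "L = 4 * \<mu>\<^sup>2 / \<nu>\<^sup>2"
  define K where "K = max c 0 / (2 * \<nu>\<^sup>2)"
  have a0: "0 \<le> a n" and d0: "0 \<le> d n" for n by (simp_all add: a_def d_def)
  have "(1 + 1 / (real n + 1) - L / (real n + 1)\<^sup>2) * (a (Suc n) + d (Suc n) / 8)
      \<le> a n + d n / 8 + K / (real n + 1)\<^sup>2" for n
  proof -
    define k where "k = real n + 1"
    define q where "q = 1 + 1 / k - L / k\<^sup>2"
    have k: "k \<ge> 1" by (simp add: k_def)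
    have g: "\<gamma> n = 1 / (2 * \<nu> * k)" by (simp add: gamma k_def)
    have q: "q = 1 + 2 * \<nu> * \<gamma> n - 16 * (\<gamma> n)\<^sup>2 * \<mu>\<^sup>2"
      using nu_pos k by (simp add: q_def g L_def power_mult_distrib power_divide)
    have "q * (norm (W (Suc n) \<omega>))\<^sup>2 + 3 / 8 * (norm (D (Suc n) \<omega>))\<^sup>2
        \<le> (norm (W n \<omega>))\<^sup>2 + 1 / 8 * (norm (D n \<omega>))\<^sup>2 + 2 * (\<gamma> n)\<^sup>2 * (norm (e n \<omega>))\<^sup>2
          - 2 * \<gamma> n * inner (W n \<omega>) (e n \<omega>)" if \<omega>: "\<omega> \<in> space M" for \<omega>
    proof -
      have "(x n \<omega> - \<gamma> n *\<^sub>R r n \<omega> - x (Suc n) \<omega>) /\<^sub>R \<gamma> n \<in> A (x (Suc n) \<omega>)"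
        unfolding iter[OF \<omega>] by (rule resolvent_mem[OF A_max gpos])
      from forward_backward_step[OF A_strong B_mono B_lip xbar gpos this y_eq]
      show ?thesis unfolding W_def D_def e_def q by (simp add: xp_def)
    qed
    then have "(\<integral>\<omega>. q * (norm (W (Suc n) \<omega>))\<^sup>2 + 3 / 8 * (norm (D (Suc n) \<omega>))\<^sup>2 \<partial>M)
        \<le> (\<integral>\<omega>. (norm (W n \<omega>))\<^sup>2 + 1 / 8 * (norm (D n \<omega>))\<^sup>2 + 2 * (\<gamma> n)\<^sup>2 * (norm (e n \<omega>))\<^sup>2
          - 2 * \<gamma> n * inner (W n \<omega>) (e n \<omega>) \<partial>M)"
      by (intro integral_mono) auto
    then have "q * a (Suc n) + 3 / 8 * d (Suc n)
        \<le> a n + 1 / 8 * d n + 2 * (\<gamma> n)\<^sup>2 * (\<integral>\<omega>. (norm (e n \<omega>))\<^sup>2 \<partial>M)"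
      by (simp add: a_def d_def orth)
    also have "\<dots> \<le> a n + 1 / 8 * d n + 2 * (\<gamma> n)\<^sup>2 * max c 0"
      using e_bd by (intro add_left_mono mult_left_mono) auto
    also have "2 * (\<gamma> n)\<^sup>2 * max c 0 = K / k\<^sup>2"
      by (simp add: g K_def power_mult_distrib power_divide)
    finally have 1: "q * a (Suc n) + 3 / 8 * d (Suc n) \<le> a n + 1 / 8 * d n + K / k\<^sup>2" .
    \<comment> \<open>The recursion needs \<open>q / 8\<close> of the new increment and 3/8 is
      available, so \<open>q <= 3\<close> closes the gap.\<close>
    have "1 / k \<le> 1" "0 \<le> L / k\<^sup>2" using k by (simp_all add: L_def)
    then have "q \<le> 3" by (simp add: q_def)
    then have "q * d (Suc n) \<le> 3 * d (Suc n)" using d0 by (rule mult_right_mono)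
    with 1 have "q * (a (Suc n) + d (Suc n) / 8) \<le> a n + d n / 8 + K / k\<^sup>2"
      by (simp add: distrib_left)
    then show ?thesis unfolding q_def k_def .
  qed
  moreover have "0 \<le> L" "0 \<le> K" by (simp_all add: L_def K_def)
  moreover have "0 \<le> a n + d n / 8" for n using a0 d0 by simp
  ultimately obtain C where C: "\<And>n. n \<ge> 1 \<Longrightarrow> a n + d n / 8 \<le> C * ln (real n + 1) / (real n + 1)"
    using log_rate_recursion[of "\<lambda>n. a n + d n / 8" L K] by auto
  have "(\<integral>\<^sup>+ \<omega>. ennreal ((norm (x n \<omega> - xbar))\<^sup>2) \<partial>M) \<le> ennreal (C * ln (real n + 1) / (real n + 1))"
    if "n \<ge> 1" for n
  proof -
    have "(\<integral>\<^sup>+ \<omega>. ennreal ((norm (x n \<omega> - xbar))\<^sup>2) \<partial>M) = ennreal (a n)"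
      unfolding a_def W_def[symmetric] by (intro nn_integral_eq_integral) auto
    also have "\<dots> \<le> ennreal (C * ln (real n + 1) / (real n + 1))"
      using C[OF that] d0[of n] by (intro ennreal_leI) simp
    finally show ?thesis .
  qed
  \<comment> \<open>An index strictly above a natural number is at least 1.\<close>
  then show ?thesis by (intro exI[of _ C]) auto
qed

end
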